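(* Let $p\in(1,\infty)$ and let $(X,d)$ be a complete uniformly $p$-convex metric space. If $(x_n)$ is a sequence in $X$ converging weakly sequentially to $x\in X$, then there is a subsequence $(x_{m_n})$ such that $b_p(\tilde\mu_N)\to x$ in $(X,d)$ as $N\to\infty$, where $\tilde\mu_N=\frac1N\sum_{n=1}^N\delta_{x_{m_n}}$. In particular, $(X,d)$ satisfies the $p$-Banach--Saks property.
   Context: A midpoint of $x,y\in X$ is a point $m$ with $d(x,m)=d(y,m)=\frac12 d(x,y)$. $(X,d)$ admits midpoints if every pair of points has a midpoint. For $a,b\ge0$ put $\mathcal{M}^p(a,b)=\left(\frac12a^p+\frac12b^p\right)^{1/p}$. For $p\in(1,\infty)$, $(X,d)$ is uniformly $p$-convex if it admits midpoints and for every $\epsilon>0$ there is $\rho_p(\epsilon)\in(0,1)$ such that for all $x,y,z\in X$ with $d(x,y)>\epsilon\mathcal{M}^p(d(x,z),d(y,z))$ and every midpoint $m$ of $x,y$ one has $d(m,z)\le(1-\rho_p(\epsilon))\mathcal{M}^p(d(x,z),d(y,z))$. For a bounded sequence $(x_n)$, the asymptotic center is the minimizer over $x\in X$ of $\omega(x,(x_n))=\limsup_{n\to\infty}d(x,x_n)$; on such spaces it exists and is unique. A bounded sequence $(x_n)$ converges weakly sequentially to $x$ if $x$ is the asymptotic center of every subsequence of $(x_n)$. For a finitely supported probability measure $\mu$ on $X$, $b_p(\mu)$ denotes its $p$-barycenter, i.e. the (unique, on such spaces) minimizer of $y\mapsto\int d(x,y)^pd\mu(x)$. $(X,d)$ satisfies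 the $p$-Banach--Saks property if every bounded sequence $(x_n)$ in $X$ has a subsequence $(x_{m_n})$ such that the sequence of $p$-barycenters $b_p\left(\frac1N\sum_{n=1}^N\delta_{x_{m_n}}\right)$ converges in $(X,d)$ as $N\to\infty$. *)

theory Defs
  imports "HOL-Probability.Probability_Mass_Function"
begin

definition is_midpoint :: "'a::metric_space \<Rightarrow> 'a \<Rightarrow> 'a \<Rightarrow> bool" where
  "is_midpoint x y m \<longleftrightarrow> dist x m = dist x y / 2 \<and> dist y m = dist x y / 2"

definition admits_midpoints :: "'a::metric_space itself \<Rightarrow> bool" where
  "admits_midpoints _ \<longleftrightarrow> (\<forall>x y :: 'a. \<exists>m. is_midpoint x y m)"

definition power_mean :: "real \<Rightarrow> real \<Rightarrow> real \<Rightarrow> real" where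
  "power_mean p a b = (a powr p / 2 + b powr p / 2) powr (1 / p)"

definition uniformly_p_convex :: "real \<Rightarrow> 'a::metric_space itself \<Rightarrow> bool" where
  "uniformly_p_convex p T \<longleftrightarrow>
     admits_midpoints T \<and>
     (\<forall>\<epsilon>>0. \<exists>\<rho>. 0 < \<rho> \<and> \<rho> < 1 \<and>
       (\<forall>x y z m :: 'a.
          dist x y > \<epsilon> * power_mean p (dist x z) (dist y z) \<longrightarrow> is_midpoint x y m \<longrightarrow>
          dist m z \<le> (1 - \<rho>) * power_mean p (dist x z) (dist y z)))"

text \<open>The limit superior is taken in the extended reals, where it always exists; for a bounded
  sequence it is finite.\<close>

definition asymptotic_radius :: "(nat \<Rightarrow> 'a::metric_space) \<Rightarrow> 'a \<Rightarrow> ereal" where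
  "asymptotic_radius xs x = limsup (\<lambda>n. ereal (dist x (xs n)))"

text \<open>In complete uniformly \<open>p\<close>-convex spaces the minimizers below (asymptotic center of a bounded
  sequence, \<open>p\<close>-barycenter) exist and are unique, so no genuine choice is made.\<close>

definition is_asymptotic_center :: "(nat \<Rightarrow> 'a::metric_space) \<Rightarrow> 'a \<Rightarrow> bool" where
  "is_asymptotic_center xs x \<longleftrightarrow> is_arg_min (asymptotic_radius xs) (\<lambda>_. True) x"

definition weakly_seq_converges :: "(nat \<Rightarrow> 'a::metric_space) \<Rightarrow> 'a \<Rightarrow> bool" where
  "weakly_seq_converges xs x \<longleftrightarrow>
     bounded (range xs) \<and>
     (\<forall>r :: nat \<Rightarrow> nat. strict_mono r \<longrightarrow> is_asymptotic_center (xs \<circ> r) x)"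

text \<open>Intended for finitely supported \<open>\<mu>\<close>: if the distance power were not integrable, the
  Bochner integral would be 0 by convention.\<close>

definition p_barycenter :: "real \<Rightarrow> 'a::metric_space pmf \<Rightarrow> 'a" where
  "p_barycenter p \<mu> =
     arg_min (\<lambda>y. measure_pmf.expectation \<mu> (\<lambda>x. dist x y powr p)) (\<lambda>_. True)"

text \<open>Sequences are indexed from 0, so for \<open>N > 0\<close> this is the uniform average of the Dirac
  measures at the first \<open>N\<close> terms, counted with multiplicity. The value at \<open>N = 0\<close> is
  unspecified.\<close>

definition empirical_pmf :: "(nat \<Rightarrow> 'a) \<Rightarrow> nat \<Rightarrow> 'a pmf" where
  "empirical_pmf xs N = map_pmf xs (pmf_of_set {..<N})"

definition p_Banach_Saks :: "real \<Rightarrow> 'a::metric_space itself \<Rightarrow> bool" where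
  "p_Banach_Saks p _ \<longleftrightarrow>
     (\<forall>xs :: nat \<Rightarrow> 'a. bounded (range xs) \<longrightarrow>
       (\<exists>r :: nat \<Rightarrow> nat. strict_mono r \<and>
         convergent (\<lambda>N. p_barycenter p (empirical_pmf (xs \<circ> r) N))))"

end

theory Submission
  imports Defs "HOL-Library.Diagonal_Subsequence"
begin

text \<open>The means of \<open>p\<close>-th powers of distances are uniformly convex in a sense independent of the
  number of points: two near-minimizers are close. Pass to a subsequence along which the distances
  to \<open>x\<close> converge to some \<open>r\<close>. As \<open>x\<close> is its asymptotic center, every point, in particular the
  barycenter of the terms chosen so far, has distance at least \<open>r - 1/N\<close> from infinitely many
  terms, and one of these is chosen next. Then the minimal means tend to \<open>r powr p\<close>, the limit of
  the means at \<open>x\<close>, and so the barycenters tend to \<open>x\<close>. For the Banach--Saks property,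
  a diagonal argument yields a subsequence whose infimal asymptotic radius does not drop under
  passing to further subsequences; its asymptotic center is then its weak limit.\<close>

section \<open>Power means, uniform convexity on bounded sets, and minimizers\<close>

lemma power_mean_le:
  assumes "0 < p" "0 \<le> a" "0 \<le> b" "a \<le> D" "b \<le> D"
  shows "power_mean p a b \<le> D"
proof -
  have "a powr p / 2 + b powr p / 2 \<le> D powr p"
    using assms powr_mono2[of p a D] powr_mono2[of p b D] by simp
  then have "power_mean p a b \<le> (D powr p) powr (1 / p)"
    unfolding power_mean_def using assms by (intro powr_mono2) auto
  also have "\<dots> = D" using assms by (simp add: powr_powr)
  finally show ?thesis .
qed

lemma power_mean_powr:
  assumes "0 < p"
  shows "power_mean p a b powr p = (a powr p + b powr p) / 2"
  using assms by (simp add: power_mean_def powr_powr field_simps)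

text \<open>Replaces the separation condition relative to the power mean by an absolute one. All
  power means involved are at most \<open>D\<close>, so a relative threshold \<epsilon> with
  \<open>\<epsilon> * D < \<delta>\<close> suffices; the denominator \<open>D + 1\<close> also
  covers \<open>D = 0\<close>.\<close>

lemma uniformly_p_convex_bounded:
  assumes "uniformly_p_convex p TYPE('a::metric_space)" "1 < p" "0 < \<delta>" "0 \<le> D"
  obtains \<rho> where "0 < \<rho>" "\<rho> < 1"
    "\<And>x y z m :: 'a. \<lbrakk>\<delta> < dist x y; dist x z \<le> D; dist y z \<le> D; is_midpoint x y m\<rbrakk>
       \<Longrightarrow> dist m z \<le> (1 - \<rho>) * power_mean p (dist x z) (dist y z)"
proof -
  define \<epsilon> where "\<epsilon> = \<delta> / (D + 1)"
  have \<epsilon>: "\<epsilon> > 0" and "\<epsilon> * D < \<delta>"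
    using assms by (auto simp: \<epsilon>_def field_simps)
  obtain \<rho> where \<rho>: "0 < \<rho>" "\<rho> < 1"
    and *: "\<And>x y z m :: 'a. \<epsilon> * power_mean p (dist x z) (dist y z) < dist x y \<Longrightarrow> is_midpoint x y m \<Longrightarrow>
          dist m z \<le> (1 - \<rho>) * power_mean p (dist x z) (dist y z)"
    using assms(1) \<epsilon> unfolding uniformly_p_convex_def by meson
  show thesis
  proof (rule that[OF \<rho>])
    fix x y z m :: 'a
    assume h: "\<delta> < dist x y" "dist x z \<le> D" "dist y z \<le> D" "is_midpoint x y m"
    have "\<epsilon> * power_mean p (dist x z) (dist y z) \<le> \<epsilon> * D"
      using \<epsilon> assms h by (intro mult_left_mono power_mean_le) auto
    then show "dist m z \<le> (1 - \<rho>) * power_mean p (dist x z) (dist y z)"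
      using \<open>\<epsilon> * D < \<delta>\<close> h by (intro *) auto
  qed
qed

text \<open>By \<open>stab\<close> a minimizing sequence is Cauchy, and by continuity its limit
  attains the infimum. Both barycenters and asymptotic centers are obtained this way.\<close>

lemma complete_space_minimizer:
  fixes f :: "'a::complete_space \<Rightarrow> real"
  assumes cont: "continuous_on UNIV f"
    and bdd: "bdd_below (range f)"
    and stab: "\<And>\<delta>. 0 < \<delta> \<Longrightarrow> \<exists>\<eta>>0. \<forall>u v. f u \<le> Inf (range f) + \<eta> \<longrightarrow> f v \<le> Inf (range f) + \<eta> \<longrightarrow> dist u v \<le> \<delta>"
  obtains x where "\<And>y. f x \<le> f y"
proof -
  let ?I = "Inf (range f)"
  have "\<exists>u. f u < ?I + inverse (Suc n)" for n
    using cInf_lessD[of "range f" "?I + inverse (Suc n)"] by auto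
  then obtain u where u: "\<And>n. f (u n) < ?I + inverse (Suc n)" by metis
  have "Cauchy u"
  proof (rule metric_CauchyI)
    fix e :: real assume "0 < e"
    then obtain \<eta> where \<eta>: "\<eta> > 0" "\<forall>a b. f a \<le> ?I + \<eta> \<longrightarrow> f b \<le> ?I + \<eta> \<longrightarrow> dist a b \<le> e / 2"
      using stab[of "e / 2"] by auto
    obtain M where M: "inverse (real (Suc M)) < \<eta>" using reals_Archimedean[OF \<eta>(1)] by auto
    have "f (u n) \<le> ?I + \<eta>" if "n \<ge> M" for n
    proof -
      have "inverse (real (Suc n)) \<le> inverse (real (Suc M))"
        using that by (intro le_imp_inverse_le) auto
      then show ?thesis using u[of n] M by linarith
    qed
    then have "dist (u m) (u n) < e" if "m \<ge> M" "n \<ge> M" for m n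
      using \<eta>(2) that \<open>0 < e\<close> by (smt (verit) field_sum_of_halves)
    then show "\<exists>M. \<forall>m\<ge>M. \<forall>n\<ge>M. dist (u m) (u n) < e" by blast
  qed
  then obtain x where x: "u \<longlonglongrightarrow> x"
    using Cauchy_convergent convergent_def by blast
  have "(\<lambda>n. f (u n)) \<longlonglongrightarrow> f x"
    using cont x by (auto simp: continuous_on_eq_continuous_at isCont_tendsto_compose)
  moreover have "(\<lambda>n. ?I + inverse (Suc n)) \<longlonglongrightarrow> ?I + 0"
    by (intro tendsto_intros LIMSEQ_inverse_real_of_nat)
  ultimately have "f x \<le> ?I"
    using u by (intro LIMSEQ_le[of "\<lambda>n. f (u n)" "f x" "\<lambda>n. ?I + inverse (Suc n)"]) (auto intro: less_imp_le)
  then show thesis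
    using cInf_lower[OF rangeI bdd] by (intro that[of x]) (meson order_trans)
qed

section \<open>Means of powers of distances and barycenters\<close>

text \<open>For \<open>0 < N\<close> this is the functional whose minimizer is the barycenter of the
  empirical measure, written as a finite sum.\<close>

definition mean_dist_powr :: "real \<Rightarrow> (nat \<Rightarrow> 'a::metric_space) \<Rightarrow> nat \<Rightarrow> 'a \<Rightarrow> real" where
  "mean_dist_powr p zs N y = (\<Sum>i<N. dist (zs i) y powr p) / N"

lemma mean_dist_powr_nonneg: "0 \<le> mean_dist_powr p zs N y"
  by (simp add: mean_dist_powr_def sum_nonneg)

lemma add_powr_le:
  fixes a b p :: real
  assumes "0 \<le> a" "0 \<le> b" "0 < p"
  shows "(a + b) powr p \<le> 2 powr p * (a powr p + b powr p)"
proof -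
  have "(a + b) powr p \<le> (2 * max a b) powr p"
    using assms by (intro powr_mono2) auto
  also have "\<dots> = 2 powr p * max a b powr p"
    using assms by (simp add: powr_mult)
  also have "\<dots> \<le> 2 powr p * (a powr p + b powr p)"
    by (intro mult_left_mono) (auto simp: max_def)
  finally show ?thesis .
qed

text \<open>If \<open>u\<close> and \<open>v\<close> are more than \<open>\<delta>\<close> apart, comparing the mean at their midpoint with the lower
  bound \<open>I\<close> forces \<open>I\<close> itself to be small, and then so is the distance between \<open>u\<close> and \<open>v\<close>.
  In this way \<open>\<eta>\<close> depends neither on \<open>N\<close> nor on a positive lower bound for \<open>I\<close>.\<close>

lemma mean_dist_powr_stability:
  assumes conv: "uniformly_p_convex p TYPE('a::metric_space)" and "1 < p" "0 < \<delta>" "0 \<le> D"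
  obtains \<eta> where "0 < \<eta>"
    "\<And>(zs :: nat \<Rightarrow> 'a) N I u v.
       \<lbrakk>0 < N; \<And>i. i < N \<Longrightarrow> dist (zs i) u \<le> D; \<And>i. i < N \<Longrightarrow> dist (zs i) v \<le> D;
        \<And>y. I \<le> mean_dist_powr p zs N y;
        mean_dist_powr p zs N u \<le> I + \<eta>; mean_dist_powr p zs N v \<le> I + \<eta>\<rbrakk>
       \<Longrightarrow> dist u v \<le> \<delta>"
proof -
  obtain \<rho> where \<rho>: "0 < \<rho>" "\<rho> < 1" and mid:
    "\<And>x y z m :: 'a. \<lbrakk>\<delta> < dist x y; dist x z \<le> D; dist y z \<le> D; is_midpoint x y m\<rbrakk>
       \<Longrightarrow> dist m z \<le> (1 - \<rho>) * power_mean p (dist x z) (dist y z)"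
    using uniformly_p_convex_bounded[OF conv \<open>1 < p\<close> \<open>0 < \<delta>\<close> \<open>0 \<le> D\<close>] by metis
  define \<theta> where "\<theta> = (1 - \<rho>) powr p"
  have \<theta>: "0 < \<theta>" "\<theta> < 1"
    using \<rho> \<open>1 < p\<close> powr_less_mono2[of p "1 - \<rho>" 1] by (auto simp: \<theta>_def)
  \<comment> \<open>\<open>C\<close> collects the factors of the last chain: the two means add up to
    at most \<open>2 * (\<eta> / (1 - \<theta>)) + 2 * \<eta>\<close>, and
    \<open>add_powr_le\<close> contributes \<open>2 powr p\<close>.\<close>
  define C where "C = 2 powr p * (2 / (1 - \<theta>) + 2)"
  have "C > 0" using \<theta> by (simp add: C_def add_pos_pos)
  define \<eta> where "\<eta> = \<delta> powr p / C"
  have \<eta>: "\<eta> > 0" "C * \<eta> = \<delta> powr p"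
    using \<open>C > 0\<close> \<open>0 < \<delta>\<close> by (auto simp: \<eta>_def)
  show thesis
  proof (rule that[OF \<eta>(1)], rule ccontr)
    fix zs :: "nat \<Rightarrow> 'a" and N I u v
    assume N: "0 < N" and D: "\<And>i. i < N \<Longrightarrow> dist (zs i) u \<le> D" "\<And>i. i < N \<Longrightarrow> dist (zs i) v \<le> D"
      and I: "\<And>y. I \<le> mean_dist_powr p zs N y"
      and u: "mean_dist_powr p zs N u \<le> I + \<eta>" and v: "mean_dist_powr p zs N v \<le> I + \<eta>"
      and far: "\<not> dist u v \<le> \<delta>"
    let ?F = "mean_dist_powr p zs N"
    have F: "(\<Sum>i<N. dist (zs i) y powr p) = N * ?F y" for y
      using N by (simp add: mean_dist_powr_def)
    obtain m where m: "is_midpoint u v m"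
      using conv unfolding uniformly_p_convex_def admits_midpoints_def by blast
    \<comment> \<open>The separation of \<open>u\<close> and \<open>v\<close> does not involve
      \<open>i\<close>, so convexity contracts every summand by the same factor \<theta>, and hence
      the whole mean.\<close>
    have "dist (zs i) m powr p \<le> \<theta> * ((dist (zs i) u powr p + dist (zs i) v powr p) / 2)" if "i < N" for i
    proof -
      have "dist m (zs i) powr p \<le> ((1 - \<rho>) * power_mean p (dist u (zs i)) (dist v (zs i))) powr p"
        using mid[of u v "zs i" m] far D[OF that] m \<open>1 < p\<close> by (intro powr_mono2) (auto simp: dist_commute)
      also have "\<dots> = \<theta> * ((dist u (zs i) powr p + dist v (zs i) powr p) / 2)"
        using \<rho> \<open>1 < p\<close> by (simp add: powr_mult power_mean_powr \<theta>_def)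
      finally show ?thesis by (simp add: dist_commute)
    qed
    then have "(\<Sum>i<N. dist (zs i) m powr p)
        \<le> (\<Sum>i<N. \<theta> * ((dist (zs i) u powr p + dist (zs i) v powr p) / 2))"
      by (intro sum_mono) auto
    also have "\<dots> = real N * (\<theta> * ((?F u + ?F v) / 2))"
      unfolding sum_distrib_left[symmetric] sum_divide_distrib[symmetric] sum.distrib F
      by (simp add: field_simps)
    finally have "?F m \<le> \<theta> * ((?F u + ?F v) / 2)"
      unfolding F using N by simp
    also have "\<dots> \<le> \<theta> * (I + \<eta>)"
      using \<theta> u v by (intro mult_left_mono) auto
    finally have "I \<le> \<theta> * (I + \<eta>)" using I[of m] by linarith
    moreover have "\<theta> * \<eta> \<le> \<eta>" using \<theta> \<eta> by simp
    ultimately have "(1 - \<theta>) * I \<le> \<eta>" by (simp add: algebra_simps)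
    then have I': "I \<le> \<eta> / (1 - \<theta>)" using \<theta> by (simp add: field_simps)
    have "real N * dist u v powr p = (\<Sum>i<N. dist u v powr p)" by simp
    also have "\<dots> \<le> (\<Sum>i<N. 2 powr p * (dist (zs i) u powr p + dist (zs i) v powr p))"
    proof (intro sum_mono)
      fix i
      have "dist u v powr p \<le> (dist (zs i) u + dist (zs i) v) powr p"
        using \<open>1 < p\<close> by (intro powr_mono2) (auto simp: dist_triangle3)
      also have "\<dots> \<le> 2 powr p * (dist (zs i) u powr p + dist (zs i) v powr p)"
        using \<open>1 < p\<close> by (intro add_powr_le) auto
      finally show "dist u v powr p \<le> 2 powr p * (dist (zs i) u powr p + dist (zs i) v powr p)" .
    qed
    also have "\<dots> = real N * (2 powr p * (?F u + ?F v))"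
      unfolding sum_distrib_left[symmetric] sum.distrib F by (simp add: algebra_simps)
    finally have "dist u v powr p \<le> 2 powr p * (?F u + ?F v)" using N by simp
    also have "\<dots> \<le> 2 powr p * (2 * (\<eta> / (1 - \<theta>)) + 2 * \<eta>)"
      using u v I' by (intro mult_left_mono) auto
    also have "\<dots> = C * \<eta>" by (simp add: C_def algebra_simps)
    also have "\<dots> = \<delta> powr p" by (rule \<eta>)
    finally show False
      using far \<open>0 < \<delta>\<close> \<open>1 < p\<close> powr_less_mono2[of p \<delta> "dist u v"] by auto
  qed
qed

lemma mean_dist_powr_minimizer:
  fixes zs :: "nat \<Rightarrow> 'a::complete_space"
  assumes conv: "uniformly_p_convex p TYPE('a)" and p: "1 < p" and N: "0 < N"
  obtains x where "\<And>y. mean_dist_powr p zs N x \<le> mean_dist_powr p zs N y"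
proof (rule complete_space_minimizer[of "mean_dist_powr p zs N"])
  let ?F = "mean_dist_powr p zs N"
  let ?I = "Inf (range ?F)"
  show "continuous_on UNIV ?F"
    unfolding mean_dist_powr_def using p N
    by (intro continuous_intros continuous_on_powr') auto
  show bdd: "bdd_below (range ?F)"
    by (rule bdd_belowI[of _ 0]) (auto simp: mean_dist_powr_nonneg)
  have I: "?I \<le> ?F y" for y using bdd by (simp add: cInf_lower)
  fix \<delta> :: real assume "0 < \<delta>"
  \<comment> \<open>On the sublevel set of \<open>?I + 1\<close> a single summand is at most the
    whole sum, that is, at most \<open>N * (?I + 1)\<close>. Here \<open>D\<close> may depend on
    \<open>N\<close>, which is fixed.\<close>
  define D where "D = (N * (?I + 1)) powr (1 / p)"
  have D: "dist (zs i) y \<le> D" if "i < N" "?F y \<le> ?I + 1" for i y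
  proof -
    have "dist (zs i) y powr p \<le> (\<Sum>i<N. dist (zs i) y powr p)"
      using that by (intro member_le_sum) auto
    also have "\<dots> = N * ?F y" using N by (simp add: mean_dist_powr_def)
    also have "\<dots> \<le> N * (?I + 1)" using that by (intro mult_left_mono) auto
    finally have "(dist (zs i) y powr p) powr (1 / p) \<le> D"
      unfolding D_def using p by (intro powr_mono2) auto
    then show ?thesis using p by (simp add: powr_powr)
  qed
  have "0 \<le> D" by (simp add: D_def)
  from mean_dist_powr_stability[OF conv p \<open>0 < \<delta>\<close> this]
  obtain \<eta> where \<eta>: "0 < \<eta>"
    "\<And>(zs :: nat \<Rightarrow> 'a) N I u v.
       \<lbrakk>0 < N; \<And>i. i < N \<Longrightarrow> dist (zs i) u \<le> D; \<And>i. i < N \<Longrightarrow> dist (zs i) v \<le> D;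
        \<And>y. I \<le> mean_dist_powr p zs N y;
        mean_dist_powr p zs N u \<le> I + \<eta>; mean_dist_powr p zs N v \<le> I + \<eta>\<rbrakk>
       \<Longrightarrow> dist u v \<le> \<delta>" by blast
  show "\<exists>\<eta>>0. \<forall>u v. ?F u \<le> ?I + \<eta> \<longrightarrow> ?F v \<le> ?I + \<eta> \<longrightarrow> dist u v \<le> \<delta>"
  \<comment> \<open>The minimum with 1 keeps both points in the sublevel set on which
    \<open>D\<close> bounds the distances.\<close>
  proof (intro exI[of _ "min \<eta> 1"] conjI allI impI)
    fix u v assume "?F u \<le> ?I + min \<eta> 1" "?F v \<le> ?I + min \<eta> 1"
    then show "dist u v \<le> \<delta>"
      using D I N by (intro \<eta>(2)[of N zs u v ?I]) auto
  qed (use \<eta> in auto)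
qed (rule that)

lemma expectation_empirical_pmf:
  assumes "0 < N"
  shows "measure_pmf.expectation (empirical_pmf zs N) (\<lambda>x. dist x y powr p) = mean_dist_powr p zs N y"
  using assms by (simp add: empirical_pmf_def mean_dist_powr_def integral_pmf_of_set lessThan_empty_iff)

text \<open>Some minimizer exists, so the choice operator inside \<open>arg_min\<close> returns
  one.\<close>

lemma p_barycenter_empirical_minimal:
  fixes zs :: "nat \<Rightarrow> 'a::complete_space"
  assumes "uniformly_p_convex p TYPE('a)" "1 < p" "0 < N"
  shows "mean_dist_powr p zs N (p_barycenter p (empirical_pmf zs N)) \<le> mean_dist_powr p zs N y"
proof -
  obtain x where x: "\<And>y. mean_dist_powr p zs N x \<le> mean_dist_powr p zs N y"
    using mean_dist_powr_minimizer[OF assms] by blast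
  have "is_arg_min (mean_dist_powr p zs N) (\<lambda>_. True) x"
    using x by (auto simp: is_arg_min_def not_less)
  then have "is_arg_min (mean_dist_powr p zs N) (\<lambda>_. True) (p_barycenter p (empirical_pmf zs N))"
    unfolding p_barycenter_def expectation_empirical_pmf[OF \<open>0 < N\<close>] arg_min_def by (rule someI)
  then show ?thesis by (auto simp: is_arg_min_def not_less)
qed

section \<open>Selecting a subsequence with convergent barycenters\<close>

text \<open>Lets the choice of the next index depend on the earlier indices alone, as recursive
  selection requires.\<close>

lemma empirical_pmf_cong:
  assumes "0 < N" "\<And>i. i < N \<Longrightarrow> xs i = ys i"
  shows "empirical_pmf xs N = empirical_pmf ys N"
  unfolding empirical_pmf_def using assms
  by (intro map_pmf_cong refl) (auto simp: set_pmf_of_set lessThan_empty_iff)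

text \<open>Adding one point to a family of \<open>N\<close> points changes the mean at a fixed point by \<open>O(1/N)\<close>, so by stability
  consecutive barycenters approach each other; hence the new point is almost as far from
  \<open>b (Suc N)\<close> as from \<open>b N\<close>, that is, almost as far as from \<open>x\<close>. Therefore the excess
  \<open>T N\<close> of the sum at \<open>x\<close> over the minimal sum grows only like \<open>o(N)\<close>.\<close>

lemma barycenters_tendsto:
  fixes zs b :: "nat \<Rightarrow> 'a::metric_space"
  assumes conv: "uniformly_p_convex p TYPE('a)" and p: "1 < p"
    and bdd: "bounded (range zs)"
    and lim: "(\<lambda>n. dist (zs n) x) \<longlonglongrightarrow> r"
    and min: "\<And>N y. 0 < N \<Longrightarrow> mean_dist_powr p zs N (b N) \<le> mean_dist_powr p zs N y"
    and far: "\<And>N. 0 < N \<Longrightarrow> r - 1 / real (Suc N) \<le> dist (zs N) (b N)"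
  shows "b \<longlonglongrightarrow> x"
proof -
  let ?F = "mean_dist_powr p zs"
  define S where "S N y = (\<Sum>i<N. dist (zs i) y powr p)" for N y
  have S: "S N y = N * ?F N y" if "0 < N" for N y
    using that by (simp add: mean_dist_powr_def S_def)
  have Smin: "S N (b N) \<le> S N y" if "0 < N" for N y
    unfolding S[OF that] using min[OF that] by (intro mult_left_mono) auto
  obtain R0 where R0: "\<And>n. dist x (zs n) \<le> R0"
    using bdd bounded_any_center[of "range zs" x] by auto
  define R where "R = max R0 1"
  have R: "dist (zs n) x \<le> R" "0 < R" for n
    using R0[of n] by (auto simp: R_def dist_commute)
  \<comment> \<open>If every point were farther than \<open>R\<close> from \<open>b N\<close>, the
    sum at \<open>x\<close> would be smaller than the minimal one; so some point is within
    \<open>R\<close> of both.\<close>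
  have bR: "dist (b N) x \<le> 2 * R" if N: "0 < N" for N
  proof -
    have "\<exists>i<N. dist (zs i) (b N) \<le> R"
    proof (rule ccontr)
      assume "\<not> ?thesis"
      then have "S N x < S N (b N)"
        unfolding S_def using R N p
        by (intro sum_strict_mono powr_less_mono2) (auto simp: not_le lessThan_empty_iff intro: le_less_trans)
      then show False using Smin[OF N, of x] by simp
    qed
    then obtain i where "dist (zs i) (b N) \<le> R" by blast
    then show ?thesis
      using R(1)[of i] dist_triangle3[of "b N" x "zs i"] by linarith
  qed
  have D: "dist (zs i) x \<le> 3 * R" "0 < N \<Longrightarrow> dist (zs i) (b N) \<le> 3 * R" for i N
    using R(1)[of i] R(2) bR[of N] dist_triangle2[of "zs i" "b N" x] by auto
  have stab: "\<exists>\<eta>>0. \<forall>N v. 0 < N \<longrightarrow> (\<forall>i. dist (zs i) v \<le> 3 * R) \<longrightarrow> ?F N v \<le> ?F N (b N) + \<eta>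
      \<longrightarrow> dist (b N) v \<le> \<delta>" if "0 < \<delta>" for \<delta>
  proof -
    have "0 \<le> 3 * R" using R by simp
    from mean_dist_powr_stability[OF conv p that this]
    obtain \<eta> where \<eta>: "0 < \<eta>"
      "\<And>(zs :: nat \<Rightarrow> 'a) N I u v.
       \<lbrakk>0 < N; \<And>i. i < N \<Longrightarrow> dist (zs i) u \<le> 3 * R; \<And>i. i < N \<Longrightarrow> dist (zs i) v \<le> 3 * R;
        \<And>y. I \<le> mean_dist_powr p zs N y;
        mean_dist_powr p zs N u \<le> I + \<eta>; mean_dist_powr p zs N v \<le> I + \<eta>\<rbrakk>
       \<Longrightarrow> dist u v \<le> \<delta>" by blast
    show ?thesis
    proof (intro exI[of _ \<eta>] conjI allI impI)
      fix N v
      assume "0 < N" "\<forall>i. dist (zs i) v \<le> 3 * R" "?F N v \<le> ?F N (b N) + \<eta>"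
      then show "dist (b N) v \<le> \<delta>"
        using D min \<eta>(1) by (intro \<eta>(2)[of N zs "b N" v "?F N (b N)"]) auto
    qed (rule \<eta>(1))
  qed
  have step: "(\<lambda>N. dist (b N) (b (Suc N))) \<longlonglongrightarrow> 0"
  proof (rule LIMSEQ_I)
    fix e :: real assume "0 < e"
    then obtain \<eta> where \<eta>: "0 < \<eta>" and
      st: "\<And>N v. \<lbrakk>0 < N; \<And>i. dist (zs i) v \<le> 3 * R; ?F N v \<le> ?F N (b N) + \<eta>\<rbrakk> \<Longrightarrow> dist (b N) v \<le> e / 2"
      using stab[of "e / 2"] by auto
    \<comment> \<open>\<open>M\<close> is chosen so that the one extra summand, at most
      \<open>(3 * R) powr p\<close>, is at most \<eta> after division by \<open>N\<close>.\<close>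
    obtain M where M: "(3 * R) powr p / \<eta> < real M" using reals_Archimedean2 by blast
    have "dist (b N) (b (Suc N)) \<le> e / 2" if "N \<ge> Suc M" for N
    proof (rule st)
      show N: "0 < N" using that by simp
      show "dist (zs i) (b (Suc N)) \<le> 3 * R" for i by (intro D) simp
      have "S N (b (Suc N)) \<le> S (Suc N) (b (Suc N))" by (simp add: S_def)
      also have "\<dots> \<le> S (Suc N) (b N)" by (intro Smin) simp
      also have "\<dots> \<le> S N (b N) + (3 * R) powr p"
        using D(2)[OF N] p by (auto simp: S_def intro!: powr_mono2)
      also have "(3 * R) powr p \<le> real M * \<eta>" using M \<eta> by (simp add: field_simps)
      also have "\<dots> \<le> real N * \<eta>" using that \<eta> by simp
      finally have "real N * ?F N (b (Suc N)) \<le> real N * (?F N (b N) + \<eta>)"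
        unfolding S[OF N] by (simp add: algebra_simps)
      then show "?F N (b (Suc N)) \<le> ?F N (b N) + \<eta>" using N by simp
    qed
    then show "\<exists>M. \<forall>N\<ge>M. norm (dist (b N) (b (Suc N)) - 0) < e"
      using \<open>0 < e\<close> by (intro exI[of _ "Suc M"]) (smt (verit) field_sum_of_halves real_norm_def zero_le_dist)
  qed
  \<comment> \<open>By \<open>far\<close> and the triangle inequality, \<open>w N\<close> is a lower
    bound for the distance from \<open>zs N\<close> to \<open>b (Suc N)\<close>. The cut-off at 0
    keeps the base of \<open>powr\<close> nonnegative, so the limit is valid even for
    \<open>r = 0\<close>.\<close>
  define w where "w N = max 0 (r - 1 / real (Suc N) - dist (b N) (b (Suc N)))" for N
  have w_nonneg: "0 \<le> w N" for N by (simp add: w_def)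
  have "0 \<le> r" using lim by (rule LIMSEQ_le_const) auto
  have "(\<lambda>N. 1 / real (Suc N)) \<longlonglongrightarrow> 0"
    using LIMSEQ_inverse_real_of_nat by (simp add: inverse_eq_divide)
  then have "w \<longlonglongrightarrow> max 0 (r - 0 - 0)"
    unfolding w_def using step by (intro tendsto_intros)
  then have w: "w \<longlonglongrightarrow> r" using \<open>0 \<le> r\<close> by simp
  define T where "T N = S N x - S N (b N)" for N
  have "(\<lambda>N. dist (zs N) x powr p - w N powr p) \<longlonglongrightarrow> r powr p - r powr p"
    using lim w p w_nonneg by (intro tendsto_diff tendsto_powr2 tendsto_const) auto
  then have d0: "(\<lambda>N. dist (zs N) x powr p - w N powr p) \<longlonglongrightarrow> 0" by simp
  \<comment> \<open>The minimal sum grows by at least \<open>dist (zs N) (b (Suc N)) powr p\<close>,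
    because \<open>S N (b (Suc N))\<close> is at least \<open>S N (b N)\<close>.\<close>
  have Tstep: "T (Suc N) - T N \<le> dist (zs N) x powr p - w N powr p" if N: "0 < N" for N
  proof -
    have "w N \<le> dist (zs N) (b (Suc N))"
      using far[OF N] dist_triangle2[of "zs N" "b N" "b (Suc N)"] by (simp add: w_def dist_commute)
    then have "w N powr p \<le> dist (zs N) (b (Suc N)) powr p"
      using p by (intro powr_mono2) (auto simp: w_def)
    then show ?thesis
      using Smin[OF N, of "b (Suc N)"] by (simp add: T_def S_def)
  qed
  have Tsmall: "\<forall>\<^sub>F N in sequentially. T N \<le> N * \<eta>" if "0 < \<eta>" for \<eta> :: real
  proof -
    obtain M0 where M0: "\<And>N. N \<ge> M0 \<Longrightarrow> dist (zs N) x powr p - w N powr p < \<eta> / 2"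
      using order_tendstoD(2)[OF d0, of "\<eta> / 2"] \<open>0 < \<eta>\<close>
      by (auto simp: eventually_sequentially)
    \<comment> \<open>The successor makes \<open>M\<close> positive, as \<open>Tstep\<close>
      demands. From \<open>M\<close> on every increment is below \<open>\<eta> / 2\<close>; the
      other half of the budget absorbs \<open>T M\<close> once \<open>N\<close> reaches
      \<open>L\<close>.\<close>
    define M where "M = Suc M0"
    have T: "T (M + k) \<le> T M + real k * (\<eta> / 2)" for k
    proof (induction k)
      case (Suc k)
      have "real (Suc k) * (\<eta> / 2) = real k * (\<eta> / 2) + \<eta> / 2" by (simp add: algebra_simps)
      moreover have "T (Suc (M + k)) - T (M + k) < \<eta> / 2"
        using Tstep[of "M + k"] M0[of "M + k"] by (simp add: M_def)
      ultimately show ?case using Suc by (simp only: add_Suc_right)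
    qed simp
    obtain L where L: "T M / (\<eta> / 2) < real L" using reals_Archimedean2 by blast
    have "T N \<le> N * \<eta>" if "N \<ge> max M L" for N
    proof -
      have "T N \<le> T M + real (N - M) * (\<eta> / 2)" using T[of "N - M"] that by simp
      also have "real (N - M) * (\<eta> / 2) \<le> real N * (\<eta> / 2)"
        using \<open>0 < \<eta>\<close> by (intro mult_right_mono) auto
      also have "T M \<le> real L * (\<eta> / 2)" using L \<open>0 < \<eta>\<close> by (simp add: field_simps)
      also have "\<dots> \<le> real N * (\<eta> / 2)" using \<open>0 < \<eta>\<close> that by simp
      finally show ?thesis by (simp add: mult.commute)
    qed
    then show ?thesis by (rule eventually_sequentiallyI)
  qed
  show ?thesis
  proof (rule tendstoI)
    fix e :: real assume "0 < e"
    then obtain \<eta> where \<eta>: "0 < \<eta>" and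
      st: "\<And>N v. \<lbrakk>0 < N; \<And>i. dist (zs i) v \<le> 3 * R; ?F N v \<le> ?F N (b N) + \<eta>\<rbrakk> \<Longrightarrow> dist (b N) v \<le> e / 2"
      using stab[of "e / 2"] by auto
    show "\<forall>\<^sub>F N in sequentially. dist (b N) x < e"
      using Tsmall[OF \<eta>] eventually_gt_at_top[of 0]
    proof eventually_elim
      case (elim N)
      then have "real N * ?F N x \<le> real N * (?F N (b N) + \<eta>)"
        by (simp add: T_def S algebra_simps)
      then have "?F N x \<le> ?F N (b N) + \<eta>" using elim by simp
      then have "dist (b N) x \<le> e / 2" using elim D(1) by (intro st) auto
      then show ?case using \<open>0 < e\<close> by simp
    qed
  qed
qed

lemma weakly_seq_converges_barycenters:
  fixes xs :: "nat \<Rightarrow> 'a::complete_space"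
  assumes conv: "uniformly_p_convex p TYPE('a)" and p: "1 < p"
    and weak: "weakly_seq_converges xs x"
  obtains s where "strict_mono s" "(\<lambda>N. p_barycenter p (empirical_pmf (xs \<circ> s) N)) \<longlonglongrightarrow> x"
proof -
  have bdd: "bounded (range xs)"
    using weak by (simp add: weakly_seq_converges_def)
  then have "bounded (range (\<lambda>n. dist (xs n) x))"
    unfolding bounded_any_center[of "range xs" x] by (auto simp: bounded_iff dist_commute)
  then obtain r t where t: "strict_mono t" and "((\<lambda>n. dist (xs n) x) \<circ> t) \<longlonglongrightarrow> r"
    using bounded_imp_convergent_subsequence by blast
  then have lim: "(\<lambda>n. dist (xs (t n)) x) \<longlonglongrightarrow> r" by (simp add: o_def)
  define ys where "ys = xs \<circ> t"
  have "is_asymptotic_center ys x"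
    using weak t by (simp add: weakly_seq_converges_def ys_def)
  then have center: "asymptotic_radius ys x \<le> asymptotic_radius ys y" for y
    by (auto simp: is_asymptotic_center_def is_arg_min_def not_less)
  have "asymptotic_radius ys x = ereal r"
    unfolding asymptotic_radius_def ys_def
    using lim by (intro lim_imp_Limsup) (auto simp: dist_commute)
  \<comment> \<open>Otherwise almost all terms would be closer to \<open>y\<close> than
    \<open>r - \<eta>\<close>, and the radius at \<open>y\<close> would undercut the radius
    \<open>r\<close> at the center.\<close>
  have freq: "\<exists>n>k. r - \<eta> \<le> dist (ys n) y" if "0 < \<eta>" for y \<eta> k
  proof (rule ccontr)
    assume "\<not> ?thesis"
    then have "\<forall>\<^sub>F n in sequentially. ereal (dist y (ys n)) \<le> ereal (r - \<eta>)"
      by (intro eventually_sequentiallyI[of "Suc k"]) (auto simp: not_le dist_commute Suc_le_eq)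
    then have "asymptotic_radius ys y \<le> ereal (r - \<eta>)"
      unfolding asymptotic_radius_def by (rule Limsup_bounded)
    with center[of y] have "ereal r \<le> ereal (r - \<eta>)"
      unfolding \<open>asymptotic_radius ys x = ereal r\<close> by (rule order_trans)
    then show False using that by simp
  qed
  \<comment> \<open>\<open>P f N k\<close> says that \<open>k\<close> is admissible as the index
    after \<open>f 0, ..., f (N - 1)\<close>. The guard \<open>0 < N\<close> is there because the
    empirical measure of no points is unspecified.\<close>
  define P where "P f N k \<longleftrightarrow> (\<forall>i<N. f i < k) \<and> (0 < N \<longrightarrow>
      r - 1 / real (Suc N) \<le> dist (ys k) (p_barycenter p (empirical_pmf (ys \<circ> f) N)))"
    for f :: "nat \<Rightarrow> nat" and N k
  \<comment> \<open>The barycenter involves all earlier terms, so this is recursion on the whole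
    history and not only on the last index.\<close>
  have "\<exists>f. \<forall>N. P f N (f N)"
  proof (rule dependent_wellorder_choice)
    fix k N :: nat and f g :: "nat \<Rightarrow> nat" assume eq: "\<And>i. i < N \<Longrightarrow> f i = g i"
    then have "0 < N \<Longrightarrow> empirical_pmf (ys \<circ> f) N = empirical_pmf (ys \<circ> g) N"
      by (intro empirical_pmf_cong) auto
    then show "P f N k = P g N k" using eq by (auto simp: P_def)
  next
    fix N :: nat and f :: "nat \<Rightarrow> nat"
    \<comment> \<open>Inserting 0 keeps the maximum meaningful for \<open>N = 0\<close>.\<close>
    have "\<exists>n>Max (insert 0 (f ` {..<N})). r - 1 / real (Suc N) \<le> dist (ys n) (p_barycenter p (empirical_pmf (ys \<circ> f) N))"
      by (rule freq) simp
    then obtain n where "n > Max (insert 0 (f ` {..<N}))"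
      "r - 1 / real (Suc N) \<le> dist (ys n) (p_barycenter p (empirical_pmf (ys \<circ> f) N))" by blast
    then show "\<exists>k. P f N k" by (auto simp: P_def intro!: exI[of _ n])
  qed
  then obtain f where f: "\<And>N. P f N (f N)" by blast
  have mono: "strict_mono f" using f by (auto simp: P_def strict_mono_def)
  show thesis
  proof (rule that)
    show "strict_mono (t \<circ> f)" using t mono by (rule strict_mono_o)
    have "(\<lambda>N. p_barycenter p (empirical_pmf (ys \<circ> f) N)) \<longlonglongrightarrow> x"
    proof (rule barycenters_tendsto[OF conv p])
      show "bounded (range (ys \<circ> f))"
        by (rule bounded_subset[OF bdd]) (auto simp: ys_def)
      show "(\<lambda>n. dist ((ys \<circ> f) n) x) \<longlonglongrightarrow> r"
        using LIMSEQ_subseq_LIMSEQ[OF lim mono] by (simp add: ys_def o_def)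
    qed (use f in \<open>auto simp: P_def intro!: p_barycenter_empirical_minimal conv p\<close>)
    then show "(\<lambda>N. p_barycenter p (empirical_pmf (xs \<circ> (t \<circ> f)) N)) \<longlonglongrightarrow> x"
      by (simp add: ys_def o_assoc)
  qed
qed

section \<open>Existence of asymptotic centers\<close>

lemma asymptotic_radius_finite:
  assumes "bounded (range xs)"
  shows "0 \<le> asymptotic_radius xs y" "asymptotic_radius xs y < \<infinity>"
proof -
  obtain R where "\<And>n. dist y (xs n) \<le> R"
    using assms bounded_any_center[of "range xs" y] by auto
  then have "asymptotic_radius xs y \<le> ereal R"
    unfolding asymptotic_radius_def by (intro Limsup_bounded) auto
  then show "asymptotic_radius xs y < \<infinity>" by (auto intro: le_less_trans)
  show "0 \<le> asymptotic_radius xs y"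
    unfolding asymptotic_radius_def by (intro le_Limsup) auto
qed

text \<open>The radius is finite and 1-Lipschitz in the point, and its near-minimizers are close by
  the same midpoint argument as for the means; \<open>complete_space_minimizer\<close> then
  applies.\<close>

lemma asymptotic_center_exists:
  fixes xs :: "nat \<Rightarrow> 'a::complete_space"
  assumes conv: "uniformly_p_convex p TYPE('a)" and p: "1 < p"
    and bdd: "bounded (range xs)"
  obtains x where "\<And>y. asymptotic_radius xs x \<le> asymptotic_radius xs y"
proof -
  define f where "f y = real_of_ereal (asymptotic_radius xs y)" for y
  have f: "asymptotic_radius xs y = ereal (f y)" for y
    using asymptotic_radius_finite[OF bdd, of y] by (auto simp: f_def ereal_real)
  have f_nonneg: "0 \<le> f y" for y
    using asymptotic_radius_finite(1)[OF bdd, of y] by (simp add: f)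
  have f_le: "f y \<le> c" if "\<forall>\<^sub>F n in sequentially. dist y (xs n) \<le> c" for y c
  proof -
    have "asymptotic_radius xs y \<le> ereal c"
      unfolding asymptotic_radius_def using that by (intro Limsup_bounded) auto
    then show ?thesis by (simp add: f)
  qed
  have f_less: "\<forall>\<^sub>F n in sequentially. dist y (xs n) < c" if "f y < c" for y c
    using Limsup_lessD[of sequentially "\<lambda>n. ereal (dist y (xs n))" "ereal c"] that
    by (simp add: asymptotic_radius_def[symmetric] f)
  have lip: "f u \<le> f v + dist u v" for u v
  proof (rule field_le_epsilon)
    fix e :: real assume "0 < e"
    then have "\<forall>\<^sub>F n in sequentially. dist v (xs n) < f v + e" by (intro f_less) simp
    then have "\<forall>\<^sub>F n in sequentially. dist u (xs n) \<le> f v + dist u v + e"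
      by eventually_elim (smt (verit) dist_triangle)
    then show "f u \<le> f v + dist u v + e" by (rule f_le)
  qed
  have "1-lipschitz_on UNIV f"
  proof (rule lipschitz_onI)
    show "dist (f u) (f v) \<le> 1 * dist u v" for u v
      using lip[of u v] lip[of v u] by (simp add: dist_real_def abs_le_iff dist_commute)
  qed simp
  then have cont: "continuous_on UNIV f" by (rule lipschitz_on_continuous_on)
  have fbdd: "bdd_below (range f)" by (rule bdd_belowI[of _ 0]) (auto simp: f_nonneg)
  let ?I = "Inf (range f)"
  have I: "?I \<le> f y" for y using fbdd by (simp add: cInf_lower)
  have "0 \<le> ?I" by (intro cInf_greatest) (auto simp: f_nonneg)
  have stab: "\<exists>\<eta>>0. \<forall>u v. f u \<le> ?I + \<eta> \<longrightarrow> f v \<le> ?I + \<eta> \<longrightarrow> dist u v \<le> \<delta>" if "0 < \<delta>" for \<delta>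
  proof -
    have "0 \<le> ?I + 2" using \<open>0 \<le> ?I\<close> by simp
    from uniformly_p_convex_bounded[OF conv p that this] obtain \<rho> where \<rho>: "0 < \<rho>" "\<rho> < 1" and
      mid: "\<And>x y z m :: 'a. \<lbrakk>\<delta> < dist x y; dist x z \<le> ?I + 2; dist y z \<le> ?I + 2; is_midpoint x y m\<rbrakk>
       \<Longrightarrow> dist m z \<le> (1 - \<rho>) * power_mean p (dist x z) (dist y z)" by metis
    \<comment> \<open>The factor \<open>4 / \<rho> + 4\<close> is the one reached in the final
      estimate of \<open>dist u v\<close>. The bound 1 keeps \<open>?I + 2 * \<eta>\<close> below
      \<open>?I + 2\<close>, the range where \<open>mid\<close> is available.\<close>
    define \<eta> where "\<eta> = min 1 (\<delta> / (4 / \<rho> + 4))"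
    have C: "4 / \<rho> + 4 > 0" using \<rho> by (simp add: add_pos_pos)
    then have \<eta>: "0 < \<eta>" "\<eta> \<le> 1" using \<open>0 < \<delta>\<close> by (auto simp: \<eta>_def)
    have "(4 / \<rho> + 4) * \<eta> \<le> (4 / \<rho> + 4) * (\<delta> / (4 / \<rho> + 4))"
      using C by (intro mult_left_mono) (auto simp: \<eta>_def)
    also have "\<dots> = \<delta>" using C by (metis nonzero_mult_div_cancel_left order_less_irrefl times_divide_eq_right)
    finally have \<eta>': "(4 / \<rho> + 4) * \<eta> \<le> \<delta>" .
    show ?thesis
    proof (intro exI[of _ \<eta>] conjI allI impI, rule \<eta>(1), rule ccontr)
      fix u v assume "f u \<le> ?I + \<eta>" "f v \<le> ?I + \<eta>" and far: "\<not> dist u v \<le> \<delta>"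
      then have "\<forall>\<^sub>F n in sequentially. dist u (xs n) < ?I + 2 * \<eta>"
        "\<forall>\<^sub>F n in sequentially. dist v (xs n) < ?I + 2 * \<eta>"
        using \<eta> by (auto intro!: f_less)
      then have ev: "\<forall>\<^sub>F n in sequentially. dist u (xs n) \<le> ?I + 2 * \<eta> \<and> dist v (xs n) \<le> ?I + 2 * \<eta>"
        by eventually_elim auto
      obtain m where m: "is_midpoint u v m"
        using conv unfolding uniformly_p_convex_def admits_midpoints_def by blast
      have "\<forall>\<^sub>F n in sequentially. dist m (xs n) \<le> (1 - \<rho>) * (?I + 2 * \<eta>)"
        using ev
      proof eventually_elim
        case (elim n)
        then have "dist m (xs n) \<le> (1 - \<rho>) * power_mean p (dist u (xs n)) (dist v (xs n))"
          using far m \<eta> by (intro mid) auto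
        also have "\<dots> \<le> (1 - \<rho>) * (?I + 2 * \<eta>)"
          using elim \<rho> p by (intro mult_left_mono power_mean_le) auto
        finally show ?case .
      qed
      \<comment> \<open>The radius at the midpoint cannot fall below \<open>?I\<close>, so the
        contraction forces \<open>?I\<close> to be of order \<open>\<eta> / \<rho>\<close>; then
        both points are near a common term.\<close>
      then have "?I \<le> (1 - \<rho>) * (?I + 2 * \<eta>)" using I[of m] f_le order_trans by blast
      then have "\<rho> * ?I \<le> 2 * \<eta> - 2 * (\<rho> * \<eta>)" by (simp add: algebra_simps)
      moreover have "0 \<le> \<rho> * \<eta>" using \<rho> \<eta> by simp
      ultimately have "\<rho> * ?I \<le> 2 * \<eta>" by linarith
      then have I': "?I \<le> 2 * \<eta> / \<rho>" using \<rho> by (simp add: field_simps)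
      obtain n where "dist u (xs n) \<le> ?I + 2 * \<eta>" "dist v (xs n) \<le> ?I + 2 * \<eta>"
        using eventually_happens[OF ev] by auto
      then have "dist u v \<le> 2 * (?I + 2 * \<eta>)" 
        by (intro order_trans[OF dist_triangle2[of u v "xs n"]]) simp
      also have "\<dots> \<le> 2 * (2 * \<eta> / \<rho> + 2 * \<eta>)" using I' by simp
      also have "\<dots> = (4 / \<rho> + 4) * \<eta>" by (simp add: algebra_simps)
      finally show False using \<eta>' far by simp
    qed
  qed
  obtain x where "\<And>y. f x \<le> f y"
    using complete_space_minimizer[OF cont fbdd stab] by blast
  then show thesis by (intro that[of x]) (simp add: f)
qed

section \<open>Regular subsequences and weak sequential compactness\<close>

lemma asymptotic_radius_subseq:
  assumes "strict_mono r"
  shows "asymptotic_radius (xs \<circ> r) y \<le> asymptotic_radius xs y"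
  using limsup_subseq_mono[OF assms, of "\<lambda>n. ereal (dist y (xs n))"]
  by (simp add: asymptotic_radius_def o_def)

text \<open>This number is what is usually called the asymptotic radius of a sequence; a sequence is
  regular if all its subsequences share it.\<close>

definition inf_radius :: "(nat \<Rightarrow> 'a::metric_space) \<Rightarrow> ereal" where
  "inf_radius xs = (INF y. asymptotic_radius xs y)"

lemma inf_radius_subseq:
  assumes "strict_mono r"
  shows "inf_radius (xs \<circ> r) \<le> inf_radius xs"
  unfolding inf_radius_def using asymptotic_radius_subseq[OF assms] by (intro INF_mono) auto

text \<open>Needed since a diagonal sequence refines a given stage only after finitely many terms
  are dropped.\<close>

lemma inf_radius_shift:
  "inf_radius (xs \<circ> (+) k) = inf_radius xs"
  using limsup_shift_k[of "\<lambda>n. ereal (dist _ (xs n))" k]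
  by (simp add: inf_radius_def asymptotic_radius_def o_def add.commute)

lemma inf_radius_finite:
  assumes "bounded (range xs)"
  shows "0 \<le> inf_radius xs" "inf_radius xs < \<infinity>"
proof -
  show "0 \<le> inf_radius xs"
    unfolding inf_radius_def using asymptotic_radius_finite(1)[OF assms] by (intro INF_greatest)
  have "inf_radius xs \<le> asymptotic_radius xs undefined"
    unfolding inf_radius_def by (rule INF_lower) simp
  then show "inf_radius xs < \<infinity>"
    using asymptotic_radius_finite(2)[OF assms] by (rule le_less_trans)
qed

text \<open>Refining a subsequence lowers \<open>inf_radius\<close> and raises \<open>low\<close>,
  the infimum over further refinements. Stage \<open>n\<close> brings the two within
  \<open>1 / Suc n\<close> of each other, and the diagonal sequence closes the gap.\<close>

lemma regular_subsequence:
  fixes xs :: "nat \<Rightarrow> 'a::metric_space"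
  assumes bdd: "bounded (range xs)"
  obtains s where "strict_mono s" "\<And>r. strict_mono r \<Longrightarrow> inf_radius (xs \<circ> s \<circ> r) = inf_radius (xs \<circ> s)"
proof -
  define low where "low s = (INF r\<in>{r. strict_mono r}. inf_radius (xs \<circ> s \<circ> r))" for s :: "nat \<Rightarrow> nat"
  define P where "P n s \<longleftrightarrow> inf_radius (xs \<circ> s) \<le> low s + ereal (1 / Suc n)" for n s
  have bdd': "bounded (range (xs \<circ> s))" for s :: "nat \<Rightarrow> nat"
    by (rule bounded_subset[OF bdd]) auto
  have low_le: "low s \<le> inf_radius (xs \<circ> s \<circ> r)" if "strict_mono r" for s r
    unfolding low_def using that by (intro INF_lower) auto
  have low_mono: "low s \<le> low (s \<circ> r)" if "strict_mono r" for s r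
    unfolding low_def[of "s \<circ> r"]
    using low_le[OF strict_mono_o[OF that]] by (intro INF_greatest) (auto simp: o_assoc)
  interpret subseqs P
  proof
    fix n :: nat and s :: "nat \<Rightarrow> nat" assume "strict_mono s"
    have "0 \<le> low s"
      unfolding low_def using inf_radius_finite(1)[OF bdd'] by (intro INF_greatest) (auto simp: comp_assoc)
    moreover have "low s < \<infinity>"
      using low_le[OF strict_mono_id] inf_radius_finite(2)[OF bdd'] by (metis comp_id le_less_trans)
    \<comment> \<open>In \<open>ereal\<close> the strict inequality relies on \<open>low s\<close>
      being finite.\<close>
    ultimately have "low s < low s + ereal (1 / Suc n)"
      by (cases "low s") auto
    then obtain r where r: "strict_mono r" "inf_radius (xs \<circ> s \<circ> r) < low s + ereal (1 / Suc n)"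
      unfolding low_def INF_less_iff by auto
    have "P n (s \<circ> r)"
      using r(2) low_mono[OF r(1), of s] by (auto simp: P_def o_assoc intro: order_trans[OF less_imp_le] add_right_mono)
    then show "\<exists>r. strict_mono r \<and> P n (s \<circ> r)" using r by blast
  qed
  \<comment> \<open>Both sides of \<open>P\<close> move in the favorable direction, so each stage's
    bound survives all later refinements, including the diagonal one.\<close>
  have stable: "P n (s \<circ> r)" if "strict_mono r" "P n s" for r s n
    using that inf_radius_subseq[of r "xs \<circ> s"] low_mono[of r s]
    by (auto simp: P_def o_assoc intro: order_trans add_right_mono)
  define d where "d = diagseq"
  show thesis
  proof (rule that)
    show "strict_mono d" unfolding d_def by (rule subseq_diagseq)
    fix r :: "nat \<Rightarrow> nat" assume r: "strict_mono r"
    show "inf_radius (xs \<circ> d \<circ> r) = inf_radius (xs \<circ> d)"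
    proof (rule antisym)
      show "inf_radius (xs \<circ> d \<circ> r) \<le> inf_radius (xs \<circ> d)" by (rule inf_radius_subseq[OF r])
      have le: "inf_radius (xs \<circ> d) \<le> inf_radius (xs \<circ> d \<circ> r) + ereal (1 / Suc k)" for k
      proof -
        \<comment> \<open>Dropping \<open>Suc k\<close> terms of \<open>d \<circ> r\<close> gives
          the subsequence \<open>r'\<close> of the tail of \<open>d\<close> for which stage
          \<open>k\<close> holds. The subtraction is never truncated, since
          \<open>n \<le> r n\<close>.\<close>
        define r' where "r' n = r (Suc k + n) - Suc k" for n
        have ge: "n \<le> r n" for n using seq_suble[OF r] .
        have r': "strict_mono r'"
        proof (rule strict_monoI)
          fix a b :: nat assume "a < b"
          then show "r' a < r' b"
            using strict_monoD[OF r, of "Suc k + a" "Suc k + b"] ge[of "Suc k + a"] by (simp add: r'_def)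
        qed
        have "r \<circ> (+) (Suc k) = (+) (Suc k) \<circ> r'"
        proof
          fix n show "(r \<circ> (+) (Suc k)) n = ((+) (Suc k) \<circ> r') n"
            using ge[of "Suc k + n"] by (simp add: r'_def)
        qed
        then have tail: "xs \<circ> (d \<circ> (+) (Suc k)) \<circ> r' = xs \<circ> d \<circ> r \<circ> (+) (Suc k)"
          by (metis comp_assoc)
        have "inf_radius (xs \<circ> d) = inf_radius (xs \<circ> (d \<circ> (+) (Suc k)))"
          using inf_radius_shift[of "xs \<circ> d" "Suc k"] by (simp add: comp_assoc)
        also have "\<dots> \<le> low (d \<circ> (+) (Suc k)) + ereal (1 / Suc k)"
          using diagseq_holds[OF stable, of k] by (simp add: P_def d_def)
        also have "\<dots> \<le> inf_radius (xs \<circ> (d \<circ> (+) (Suc k)) \<circ> r') + ereal (1 / Suc k)"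
          using low_le[OF r'] by (intro add_right_mono)
        also have "\<dots> = inf_radius (xs \<circ> d \<circ> r) + ereal (1 / Suc k)"
          by (simp only: tail inf_radius_shift)
        finally show ?thesis .
      qed
      show "inf_radius (xs \<circ> d) \<le> inf_radius (xs \<circ> d \<circ> r)"
      proof (rule ereal_le_epsilon2)
        fix e :: real assume "0 < e"
        then obtain k where "1 / real (Suc k) < e"
          using reals_Archimedean[of e] unfolding inverse_eq_divide by blast
        then have "inf_radius (xs \<circ> d \<circ> r) + ereal (1 / Suc k) \<le> inf_radius (xs \<circ> d \<circ> r) + ereal e"
          by (intro add_left_mono) simp
        with le[of k] show "inf_radius (xs \<circ> d) \<le> inf_radius (xs \<circ> d \<circ> r) + ereal e"
          by (rule order_trans)
      qed
    qed
  qed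
qed

text \<open>Along subsequences of a regular sequence the radius at its center \<open>x\<close>
  cannot increase while the infimum stays the same, so \<open>x\<close> remains a minimizer.\<close>

lemma weakly_convergent_subsequence:
  fixes xs :: "nat \<Rightarrow> 'a::complete_space"
  assumes conv: "uniformly_p_convex p TYPE('a)" and p: "1 < p"
    and bdd: "bounded (range xs)"
  obtains s x where "strict_mono s" "weakly_seq_converges (xs \<circ> s) x"
proof -
  obtain s where s: "strict_mono s"
    and reg: "\<And>r. strict_mono r \<Longrightarrow> inf_radius (xs \<circ> s \<circ> r) = inf_radius (xs \<circ> s)"
    using regular_subsequence[OF bdd] by blast
  have bdd': "bounded (range (xs \<circ> s))" by (rule bounded_subset[OF bdd]) auto
  obtain x where x: "\<And>y. asymptotic_radius (xs \<circ> s) x \<le> asymptotic_radius (xs \<circ> s) y"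
    using asymptotic_center_exists[OF conv p bdd'] by blast
  have "asymptotic_radius (xs \<circ> s \<circ> r) x \<le> asymptotic_radius (xs \<circ> s \<circ> r) y" if "strict_mono r" for r y
  proof -
    have "asymptotic_radius (xs \<circ> s \<circ> r) x \<le> asymptotic_radius (xs \<circ> s) x"
      by (rule asymptotic_radius_subseq[OF that])
    also have "\<dots> \<le> inf_radius (xs \<circ> s)" unfolding inf_radius_def using x by (intro INF_greatest)
    also have "\<dots> = inf_radius (xs \<circ> s \<circ> r)" by (rule reg[OF that, symmetric])
    also have "\<dots> \<le> asymptotic_radius (xs \<circ> s \<circ> r) y" unfolding inf_radius_def by (rule INF_lower) simp
    finally show ?thesis .
  qed
  then have "weakly_seq_converges (xs \<circ> s) x"
    using bdd' by (auto simp: weakly_seq_converges_def is_asymptotic_center_def is_arg_min_def not_less)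
  with s show thesis by (rule that)
qed

theorem theorem44:
  fixes p :: real
  assumes "1 < p"
    and "uniformly_p_convex p TYPE('a::complete_space)"
  shows "(\<forall>(xs :: nat \<Rightarrow> 'a) x. weakly_seq_converges xs x \<longrightarrow>
            (\<exists>r :: nat \<Rightarrow> nat. strict_mono r \<and>
               (\<lambda>N. p_barycenter p (empirical_pmf (xs \<circ> r) N)) \<longlonglongrightarrow> x))
         \<and> p_Banach_Saks p TYPE('a)"
proof (intro conjI allI impI)
  fix xs :: "nat \<Rightarrow> 'a" and x
  assume "weakly_seq_converges xs x"
  then show "\<exists>r :: nat \<Rightarrow> nat. strict_mono r \<and>
      (\<lambda>N. p_barycenter p (empirical_pmf (xs \<circ> r) N)) \<longlonglongrightarrow> x"
    using weakly_seq_converges_barycenters[OF assms(2,1)] by metis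
next
  show "p_Banach_Saks p TYPE('a)"
    unfolding p_Banach_Saks_def
  proof (intro allI impI)
    fix xs :: "nat \<Rightarrow> 'a" assume "bounded (range xs)"
    then obtain s x where s: "strict_mono s" "weakly_seq_converges (xs \<circ> s) x"
      using weakly_convergent_subsequence[OF assms(2,1)] by blast
    obtain r where r: "strict_mono r"
      "(\<lambda>N. p_barycenter p (empirical_pmf (xs \<circ> s \<circ> r) N)) \<longlonglongrightarrow> x"
      using weakly_seq_converges_barycenters[OF assms(2,1) s(2)] by blast
    show "\<exists>r. strict_mono r \<and> convergent (\<lambda>N. p_barycenter p (empirical_pmf (xs \<circ> r) N))"
      using strict_mono_o[OF s(1) r(1)] r(2)
      by (intro exI[of _ "s \<circ> r"]) (auto simp: convergent_def o_assoc)
  qed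
qed

end
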